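(* Let $n\ge 1$ and let $A:[0,\infty]^n\to[0,\infty]$ be a proper aggregation function. Define $\tilde A:[0,\infty]\to[0,\infty]$ by $\tilde A(x)=A(x,x,\ldots,x)$ and, for every $i\in\{1,\ldots,n\}$, define $A_i:[0,\infty]\to[0,\infty]$ by $A_i(x)=A(x\mathbf{e}_i)$, where $\mathbf{e}_i$ is the $i$-th unit vector (so $x$ is in the $i$-th coordinate and all other coordinates are $0$). Then: (i) $A|_{[0,\infty[^n}\in\mathcal{K}_n^*$ if and only if $\tilde A|_{[0,\infty[}\in\mathcal{K}_1^*$; and (ii) $A|_{[0,\infty[^n}\in\mathcal{K}_*^n$ if and only if $A_i|_{[0,\infty[}\in\mathcal{K}_*^1$ for some $i\in\{1,2,\ldots,n\}$.
   Context: $[0,\infty[$ denotes the half-open interval of finite non-negative reals and $]0,\infty[$ the open interval of positive reals. An ($n$-ary) aggregation function is a map $A:[0,\infty]^n\to[0,\infty]$ with $A(0,\ldots,0)=0$ that is increasing (in the sense of non-decreasing) in each coordinate. It is called proper if (a) $A(\mathbf{x})\in\,]0,\infty[$ for some $\mathbf{x}\in\,]0,\infty[^n$, and (b) $A(\mathbf{x})<\infty$ for all $\mathbf{x}\in[0,\infty[^n$. The class of proper $n$-ary aggregation functions is denoted $\mathcal{P}_n$. For an aggregation function $A$, the subadditive transformation $A_*:[0,\infty]^n\to[0,\infty]$ and the superadditive transformation $A^*:[0,\infty]^n\to[0,\infty]$ are $$A_*(\mathbf{x})=\inf\Big\{\sum_{i=1}^k A(\mathbf{y}^{(i)})\ \Big|\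 \sum_{i=1}^k \mathbf{y}^{(i)}\ge\mathbf{x}\Big\},\qquad A^*(\mathbf{x})=\sup\Big\{\sum_{j=1}^{\ell} A(\mathbf{y}^{(j)})\ \Big|\ \sum_{j=1}^{\ell} \mathbf{y}^{(j)}\le\mathbf{x}\Big\},$$ where $k,\ell$ range over all positive integers, the $\mathbf{y}^{(i)},\mathbf{y}^{(j)}$ range over $[0,\infty]^n$, and vector inequalities are coordinatewise. $\mathcal{K}_*^n$ is the class of all restrictions to $[0,\infty[^n$ of functions $A\in\mathcal{P}_n$ such that $A_*\in\mathcal{P}_n$. $\mathcal{K}_n^*$ is the class of all restrictions to $[0,\infty[^n$ of functions $A\in\mathcal{P}_n$ such that $A^*\in\mathcal{P}_n$. (Since both properness and the values of $A_*,A^*$ at points of $[0,\infty[^n$ depend only on $A|_{[0,\infty[^n}$, membership does not depend on how the function is extended to $[0,\infty]^n$.) *)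

theory Defs
  imports "HOL-Analysis.Analysis"
begin

text \<open>
  \<^typ>\<open>ennreal\<close> is \<open>[0,\<infinity>]\<close>, and \<open>ennreal ^ 'n\<close> is \<open>[0,\<infinity>]\<^sup>n\<close> with \<open>n = CARD('n) \<ge> 1\<close>; addition and
  \<open>\<le>\<close> on vectors are the coordinatewise ones.
\<close>

definition aggregation_function :: "(ennreal ^ 'n \<Rightarrow> ennreal) \<Rightarrow> bool" where
  "aggregation_function A \<longleftrightarrow>
     A 0 = 0 \<and> (\<forall>x i. mono (\<lambda>t. A (\<chi> j. if j = i then t else x $ j)))"

definition finite_vecs :: "(ennreal ^ 'n) set" where
  "finite_vecs = {x. \<forall>i. x $ i < \<infinity>}"

definition positive_finite_vecs :: "(ennreal ^ 'n) set" where
  "positive_finite_vecs = {x. \<forall>i. 0 < x $ i \<and> x $ i < \<infinity>}"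

definition proper_aggregation :: "(ennreal ^ 'n \<Rightarrow> ennreal) set" where
  "proper_aggregation = {A. aggregation_function A \<and>
     (\<exists>x \<in> positive_finite_vecs. 0 < A x \<and> A x < \<infinity>) \<and>
     (\<forall>x \<in> finite_vecs. A x < \<infinity>)}"

definition subadd_transform :: "(ennreal ^ 'n \<Rightarrow> ennreal) \<Rightarrow> ennreal ^ 'n \<Rightarrow> ennreal" where
  "subadd_transform A x =
     Inf {(\<Sum>i=1..k. A (y i)) | (k::nat) (y :: nat \<Rightarrow> ennreal ^ 'n). k \<ge> 1 \<and> (\<Sum>i=1..k. y i) \<ge> x}"

definition superadd_transform :: "(ennreal ^ 'n \<Rightarrow> ennreal) \<Rightarrow> ennreal ^ 'n \<Rightarrow> ennreal" where
  "superadd_transform A x =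
     Sup {(\<Sum>j=1..l. A (y j)) | (l::nat) (y :: nat \<Rightarrow> ennreal ^ 'n). l \<ge> 1 \<and> (\<Sum>j=1..l. y j) \<le> x}"

text \<open>
  Functions on \<open>[0,\<infinity>[\<^sup>n\<close> are represented as elements of \<open>extensional finite_vecs\<close>, i.e. with the
  fixed value \<^const>\<open>undefined\<close> off \<^const>\<open>finite_vecs\<close>.
\<close>

definition K_sub :: "(ennreal ^ 'n \<Rightarrow> ennreal) set" where
  "K_sub = {restrict A finite_vecs | A.
     A \<in> proper_aggregation \<and> subadd_transform A \<in> proper_aggregation}"

definition K_super :: "(ennreal ^ 'n \<Rightarrow> ennreal) set" where
  "K_super = {restrict A finite_vecs | A.
     A \<in> proper_aggregation \<and> superadd_transform A \<in> proper_aggregation}"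

definition diagonal_function :: "(ennreal ^ 'n \<Rightarrow> ennreal) \<Rightarrow> ennreal \<Rightarrow> ennreal" where
  "diagonal_function A x = A (\<chi> i. x)"

definition axis_function :: "(ennreal ^ 'n \<Rightarrow> ennreal) \<Rightarrow> 'n \<Rightarrow> ennreal \<Rightarrow> ennreal" where
  "axis_function A i x = A (axis i x)"

text \<open>Identifies functions on \<open>[0,\<infinity>]\<close> with functions on \<open>[0,\<infinity>]\<^sup>1\<close>.\<close>

definition unary :: "(ennreal \<Rightarrow> ennreal) \<Rightarrow> ennreal ^ 1 \<Rightarrow> ennreal" where
  "unary f x = f (x $ 1)"

end

theory Submission
  imports Defs
begin

text \<open>
  Since \<open>A\<^sub>* \<le> A \<le> A\<^sup>*\<close>, the only way for \<open>A\<^sub>*\<close> to fail to be proper is to vanish on all finite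
  vectors, and the only way for \<open>A\<^sup>*\<close> to fail is to be infinite at some finite vector.
  For (i), \<open>A (y) \<le> A (s, \<dots>, s)\<close> where \<open>s\<close> is the coordinate sum of \<open>y\<close>, so \<open>A\<^sup>*\<close> is bounded
  at \<open>x\<close> by the transform of the diagonal at the coordinate sum of \<open>x\<close>.
  For (ii), \<open>A\<^sub>*\<close> restricted to the \<open>i\<close>-th axis is the transform of \<open>A\<^sub>i\<close>, and by subadditivity
  \<open>A\<^sub>*\<close> vanishes as soon as it vanishes on all axes.
\<close>

section \<open>Monotonicity in the product order and properness\<close>

lemma aggregation_function_iff:
  "aggregation_function A \<longleftrightarrow> A 0 = 0 \<and> (\<forall>x y. x \<le> y \<longrightarrow> A x \<le> A y)"
proof (intro iffI conjI allI impI)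
  assume A: "aggregation_function A"
  then show "A 0 = 0" by (simp add: aggregation_function_def)
  fix x y :: "ennreal ^ 'a"
  assume xy: "x \<le> y"
  \<comment> \<open>The hybrid vector takes the coordinates in \<open>S\<close> from
    \<open>y\<close> and the others from \<open>x\<close>. Enlarging \<open>S\<close> by one index
    raises a single coordinate, and \<open>S = UNIV\<close> yields \<open>y\<close>.\<close>
  have "A x \<le> A (\<chi> j. if j \<in> S then y $ j else x $ j)" if "finite S" for S
    using that
  proof (induction S rule: finite_induct)
    case empty
    then show ?case by simp
  next
    case (insert i S)
    define z where "z = (\<chi> j. if j \<in> S then y $ j else x $ j)"
    have "mono (\<lambda>t. A (\<chi> j. if j = i then t else z $ j))"
      using A by (simp add: aggregation_function_def)
    from monoD[OF this, of "x $ i" "y $ i"]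
    have "A (\<chi> j. if j = i then x $ i else z $ j) \<le> A (\<chi> j. if j = i then y $ i else z $ j)"
      using xy by (simp add: less_eq_vec_def)
    moreover have "(\<chi> j. if j = i then x $ i else z $ j) = z"
      using insert by (auto simp: z_def vec_eq_iff)
    moreover have "(\<chi> j. if j = i then y $ i else z $ j)
        = (\<chi> j. if j \<in> insert i S then y $ j else x $ j)"
      by (auto simp: z_def vec_eq_iff)
    ultimately show ?case using insert z_def by (metis order_trans)
  qed
  from this[of UNIV] show "A x \<le> A y" by simp
next
  assume "A 0 = 0 \<and> (\<forall>x y. x \<le> y \<longrightarrow> A x \<le> A y)"
  then show "aggregation_function A"
    by (auto simp: aggregation_function_def less_eq_vec_def intro!: monoI)
qed

lemma aggregation_zero: "aggregation_function A \<Longrightarrow> A 0 = 0"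
  and aggregation_mono: "aggregation_function A \<Longrightarrow> x \<le> y \<Longrightarrow> A x \<le> A y"
  by (auto simp: aggregation_function_iff)

lemma finite_vecs_downward: "y \<in> finite_vecs \<Longrightarrow> x \<le> y \<Longrightarrow> x \<in> finite_vecs"
  by (auto simp: finite_vecs_def less_eq_vec_def intro: le_less_trans)

text \<open>A positive value at a finite vector with zero coordinates suffices: adding 1 to every
  coordinate makes the vector strictly positive and does not decrease the value.\<close>

lemma proper_aggregation_iff:
  "A \<in> proper_aggregation \<longleftrightarrow> aggregation_function A \<and>
     (\<exists>x\<in>finite_vecs. 0 < A x) \<and> (\<forall>x\<in>finite_vecs. A x < \<infinity>)"
proof
  assume R: "aggregation_function A \<and>
     (\<exists>x\<in>finite_vecs. 0 < A x) \<and> (\<forall>x\<in>finite_vecs. A x < \<infinity>)"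
  then obtain x where x: "x \<in> finite_vecs" "0 < A x" by blast
  let ?z = "x + (\<chi> i. 1)"
  have "?z \<in> positive_finite_vecs" "?z \<in> finite_vecs"
    using x(1) by (auto simp: positive_finite_vecs_def finite_vecs_def add_pos_pos zero_less_iff_neq_zero)
  moreover have "A x \<le> A ?z"
    using R by (intro aggregation_mono) (auto simp: less_eq_vec_def)
  ultimately show "A \<in> proper_aggregation"
    using R x(2) unfolding proper_aggregation_def by (auto dest: less_le_trans)
qed (auto simp: proper_aggregation_def positive_finite_vecs_def finite_vecs_def)

section \<open>The subadditive transformation\<close>

text \<open>Arbitrary finite index sets allow covers to be joined by disjoint union without
  renumbering.\<close>

lemma subadd_transform_le:
  assumes "aggregation_function A" "finite I" "x \<le> (\<Sum>i\<in>I. y i)"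
  shows "subadd_transform A x \<le> (\<Sum>i\<in>I. A (y i))"
proof (cases "I = {}")
  case True
  \<comment> \<open>The definition requires at least one member, so the empty cover is replaced by
    the single vector 0, whose cost is \<open>A 0 = 0\<close>.\<close>
  then show ?thesis
    using assms(3) aggregation_zero[OF assms(1)] unfolding subadd_transform_def
    by (intro Inf_lower) (auto intro!: exI[of _ "1::nat"] exI[of _ "\<lambda>_. 0"])
next
  case False
  obtain h where h: "bij_betw h {1..card I} I"
    using assms(2) ex_bij_betw_nat_finite_1 by blast
  have "card I \<ge> 1"
    using False assms(2) by (simp add: Suc_le_eq card_gt_0_iff)
  moreover have "(\<Sum>i=1..card I. y (h i)) = (\<Sum>i\<in>I. y i)"
    "(\<Sum>i=1..card I. A (y (h i))) = (\<Sum>i\<in>I. A (y i))"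
    by (rule sum.reindex_bij_betw[OF h])+
  ultimately show ?thesis
    using assms(3) unfolding subadd_transform_def
    by (intro Inf_lower CollectI exI[of _ "card I"] exI[of _ "\<lambda>i. y (h i)"]) auto
qed

text \<open>The premise includes \<open>k = 0\<close>, which spares tracking
  \<open>k \<ge> 1\<close>; it can be met because \<open>subadd_transform_le\<close> accepts empty
  covers too.\<close>

lemma le_subadd_transformI:
  assumes "\<And>(k::nat) y. x \<le> (\<Sum>i=1..k. y i) \<Longrightarrow> c \<le> (\<Sum>i=1..k. A (y i))"
  shows "c \<le> subadd_transform A x"
  unfolding subadd_transform_def using assms by (intro Inf_greatest) auto

lemma subadd_transform_le_self: "aggregation_function A \<Longrightarrow> subadd_transform A x \<le> A x"
  using subadd_transform_le[of A "{()}" x "\<lambda>_. x"] by simp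

lemma aggregation_subadd_transform:
  assumes "aggregation_function A"
  shows "aggregation_function (subadd_transform A)"
  unfolding aggregation_function_iff
proof (intro conjI allI impI)
  show "subadd_transform A 0 = 0"
    using subadd_transform_le_self[OF assms, of 0] aggregation_zero[OF assms] by simp
  fix x y :: "ennreal ^ 'a"
  assume "x \<le> y"
  then show "subadd_transform A x \<le> subadd_transform A y"
    by (intro le_subadd_transformI subadd_transform_le[OF assms]) auto
qed

text \<open>Nearly optimal covers of \<open>x\<close> and \<open>y\<close>, taken together, cover
  \<open>x + y\<close>.\<close>

lemma subadd_transform_add:
  assumes "aggregation_function A"
  shows "subadd_transform A (x + y) \<le> subadd_transform A x + subadd_transform A y"
proof (rule ennreal_le_epsilon)
  fix e :: real
  assume fin: "subadd_transform A x + subadd_transform A y < top" and e: "0 < e"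
  have cover: "\<exists>(k::nat) u. z \<le> (\<Sum>i=1..k. u i) \<and>
      (\<Sum>i=1..k. A (u i)) < subadd_transform A z + ennreal (e/2)"
    if "subadd_transform A z < top" for z
  proof (rule ccontr)
    \<comment> \<open>If every cover cost at least e/2 more than the infimum, the infimum would
      exceed itself by e/2, which is absurd for a finite value.\<close>
    assume "\<not> ?thesis"
    then have "subadd_transform A z + ennreal (e/2) \<le> subadd_transform A z"
      by (intro le_subadd_transformI) (meson not_less)
    then show False
      using that e by (simp add: ennreal_add_left_cancel_le[of _ _ 0, simplified])
  qed
  obtain k :: nat and u where u: "x \<le> (\<Sum>i=1..k. u i)"
      "(\<Sum>i=1..k. A (u i)) < subadd_transform A x + ennreal (e/2)"
    using cover[of x] fin by auto
  obtain l :: nat and v where v: "y \<le> (\<Sum>i=1..l. v i)"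
      "(\<Sum>i=1..l. A (v i)) < subadd_transform A y + ennreal (e/2)"
    using cover[of y] fin by auto
  have "x + y \<le> (\<Sum>i\<in>{1..k} <+> {1..l}. case_sum u v i)"
    using u(1) v(1) by (simp add: sum.Plus less_eq_vec_def add_mono)
  from subadd_transform_le[OF assms _ this]
  have "subadd_transform A (x + y) \<le> (\<Sum>i=1..k. A (u i)) + (\<Sum>i=1..l. A (v i))"
    by (simp add: sum.Plus)
  also have "\<dots> \<le> (subadd_transform A x + ennreal (e/2)) + (subadd_transform A y + ennreal (e/2))"
    using u(2) v(2) by (intro add_mono less_imp_le)
  also have "\<dots> = subadd_transform A x + subadd_transform A y + (ennreal (e/2) + ennreal (e/2))"
    by (simp add: ac_simps)
  also have "ennreal (e/2) + ennreal (e/2) = ennreal e"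
    using e by (simp flip: ennreal_plus)
  finally show "subadd_transform A (x + y) \<le> subadd_transform A x + subadd_transform A y + ennreal e" .
qed

lemma subadd_transform_sum:
  assumes "aggregation_function A" "finite I"
  shows "subadd_transform A (\<Sum>i\<in>I. x i) \<le> (\<Sum>i\<in>I. subadd_transform A (x i))"
  using assms(2)
proof (induction I rule: finite_induct)
  case empty
  then show ?case using subadd_transform_le_self[of A 0] assms(1) aggregation_zero by fastforce
next
  case (insert i I)
  then show ?case
    using subadd_transform_add[of A "x i" "\<Sum>i\<in>I. x i", OF assms(1)]
    by (auto intro: order_trans add_left_mono)
qed

text \<open>
  A cover of a finite \<open>x\<close> may use infinite vectors; truncating its members at \<open>x\<close> gives a finite
  cover that is no more expensive.
\<close>

lemma subadd_transform_cong:
  assumes A: "aggregation_function A" and B: "aggregation_function B"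
    and eq: "\<And>x. x \<in> finite_vecs \<Longrightarrow> A x = B x" and x: "x \<in> finite_vecs"
  shows "subadd_transform A x = subadd_transform B x"
proof -
  have le: "subadd_transform A x \<le> subadd_transform B x"
    if A: "aggregation_function A" and B: "aggregation_function B"
      and eq: "\<And>x. x \<in> finite_vecs \<Longrightarrow> A x = B x" for A B :: "ennreal ^ 'a \<Rightarrow> ennreal"
  proof (rule le_subadd_transformI)
    fix k :: nat and y :: "nat \<Rightarrow> ennreal ^ 'a"
    assume xy: "x \<le> (\<Sum>i=1..k. y i)"
    define z where "z i = (\<chi> j. min (y i $ j) (x $ j))" for i
    \<comment> \<open>Truncation at c is subadditive: once a summand reaches c, the truncated sum is
      already at least c. As \<open>x\<close> lies below the full sum, truncating that sum at
      \<open>x\<close> gives \<open>x\<close>.\<close>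
    have "min (\<Sum>i\<in>I. y i $ j) (x $ j) \<le> (\<Sum>i\<in>I. z i $ j)" if "finite I" for I :: "nat set" and j
      using that
    proof (induction I rule: finite_induct)
      case (insert i I)
      have "min (a + b) c \<le> min a c + min b c" for a b c :: ennreal
      proof (cases "a \<le> c \<and> b \<le> c")
        case False
        then have "min a c = c \<or> min b c = c" by (auto simp: min_def)
        then have "c \<le> min a c + min b c" by (auto simp: add_increasing add_increasing2)
        then show ?thesis by (rule min.coboundedI2)
      qed (simp add: min.absorb1)
      from order_trans[OF this add_left_mono[OF insert.IH]] insert.hyps show ?case
        by (simp add: z_def)
    qed simp
    from this[of "{1..k}"] have "x \<le> (\<Sum>i=1..k. z i)"
      using xy by (simp add: less_eq_vec_def min.absorb2)
    then have "subadd_transform A x \<le> (\<Sum>i=1..k. A (z i))"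
      by (intro subadd_transform_le[OF A]) auto
    also have "\<dots> \<le> (\<Sum>i=1..k. B (y i))"
    proof (rule sum_mono)
      fix i
      have "z i \<in> finite_vecs"
        by (rule finite_vecs_downward[OF x]) (simp add: z_def less_eq_vec_def)
      then have "A (z i) = B (z i)" by (rule eq)
      also have "\<dots> \<le> B (y i)"
        by (rule aggregation_mono[OF B]) (simp add: z_def less_eq_vec_def)
      finally show "A (z i) \<le> B (y i)" .
    qed
    finally show "subadd_transform A x \<le> (\<Sum>i=1..k. B (y i))" .
  qed
  show ?thesis
    using le[OF A B eq] le[OF B A eq[symmetric]] by (rule antisym)
qed

section \<open>Membership in \<open>K_sub\<close> and reduction to the axes\<close>

text \<open>Membership only provides some \<open>B\<close> agreeing with \<open>A\<close> on finite
  vectors, and \<open>subadd_transform_cong\<close> makes the choice of extension irrelevant.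
  Properness of \<open>A\<close> is derived rather than assumed, from positivity of the transform
  below it: an axis function may vanish identically.\<close>

lemma restrict_in_K_sub_iff:
  assumes A: "aggregation_function A" and fin: "\<And>x. x \<in> finite_vecs \<Longrightarrow> A x < \<infinity>"
  shows "restrict A finite_vecs \<in> K_sub \<longleftrightarrow> (\<exists>x\<in>finite_vecs. 0 < subadd_transform A x)"
proof
  assume "restrict A finite_vecs \<in> K_sub"
  then obtain B where B: "restrict A finite_vecs = restrict B finite_vecs"
      "B \<in> proper_aggregation" "subadd_transform B \<in> proper_aggregation"
    by (auto simp: K_sub_def)
  have "A x = B x" if "x \<in> finite_vecs" for x
    using B(1) that by (metis restrict_apply')
  then have "subadd_transform A x = subadd_transform B x" if "x \<in> finite_vecs" for x
    using A B(2) that by (intro subadd_transform_cong) (auto simp: proper_aggregation_iff)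
  then show "\<exists>x\<in>finite_vecs. 0 < subadd_transform A x"
    using B(3) by (auto simp: proper_aggregation_iff)
next
  assume pos: "\<exists>x\<in>finite_vecs. 0 < subadd_transform A x"
  note le = subadd_transform_le_self[OF A]
  have "A \<in> proper_aggregation" "subadd_transform A \<in> proper_aggregation"
    using A fin pos aggregation_subadd_transform[OF A]
    by (auto simp: proper_aggregation_iff intro: less_le_trans[OF _ le] le_less_trans[OF le])
  then show "restrict A finite_vecs \<in> K_sub" by (auto simp: K_sub_def)
qed

lemma aggregation_axis_function:
  assumes "aggregation_function A"
  shows "aggregation_function (unary (axis_function A i))"
  using assms unfolding aggregation_function_iff unary_def axis_function_def
  by (auto simp: less_eq_vec_def axis_def zero_vec_def[symmetric])

text \<open>Projecting a cover to the axis keeps it a cover of the axis point and, by monotonicity,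
  does not raise its cost. Conversely, a scalar cover placed on the axis is a vector cover of equal
  cost.\<close>

lemma subadd_transform_axis:
  assumes A: "aggregation_function A"
  shows "subadd_transform (unary (axis_function A i)) x = subadd_transform A (axis i (x $ 1))"
proof (rule antisym)
  show "subadd_transform (unary (axis_function A i)) x \<le> subadd_transform A (axis i (x $ 1))"
  proof (rule le_subadd_transformI)
    fix k :: nat and y
    assume cover: "axis i (x $ 1) \<le> (\<Sum>j=1..k. y j)"
    have "x \<le> (\<Sum>j=1..k. \<chi> _. y j $ i)"
      using cover[unfolded less_eq_vec_def, rule_format, of i]
      by (simp add: less_eq_vec_def)
    from subadd_transform_le[OF aggregation_axis_function[OF A] _ this, of i]
    have "subadd_transform (unary (axis_function A i)) x \<le> (\<Sum>j=1..k. A (axis i (y j $ i)))"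
      by (simp add: unary_def axis_function_def)
    also have "\<dots> \<le> (\<Sum>j=1..k. A (y j))"
      by (intro sum_mono aggregation_mono[OF A]) (auto simp: less_eq_vec_def axis_def)
    finally show "subadd_transform (unary (axis_function A i)) x \<le> (\<Sum>j=1..k. A (y j))" .
  qed
  show "subadd_transform A (axis i (x $ 1)) \<le> subadd_transform (unary (axis_function A i)) x"
  proof (rule le_subadd_transformI)
    fix k :: nat and y
    assume cover: "x \<le> (\<Sum>j=1..k. y j :: ennreal ^ 1)"
    have "axis i (x $ 1) \<le> (\<Sum>j=1..k. axis i (y j $ 1))"
      using cover by (auto simp: less_eq_vec_def axis_def)
    from subadd_transform_le[OF A _ this]
    show "subadd_transform A (axis i (x $ 1)) \<le> (\<Sum>j=1..k. unary (axis_function A i) (y j))"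
      by (simp add: unary_def axis_function_def)
  qed
qed

lemma subadd_transform_pos_iff_axis:
  assumes A: "aggregation_function A"
  shows "(\<exists>x\<in>finite_vecs. 0 < subadd_transform A x) \<longleftrightarrow>
    (\<exists>i. \<exists>t<\<infinity>. 0 < subadd_transform A (axis i t))"
proof
  assume "\<exists>x\<in>finite_vecs. 0 < subadd_transform A x"
  then obtain x where x: "x \<in> finite_vecs" "0 < subadd_transform A x" by blast
  \<comment> \<open>Subadditivity along this decomposition bounds a positive value by a sum over the
    axes, so some term is positive.\<close>
  have "x = (\<Sum>i\<in>UNIV. axis i (x $ i))"
    by (simp add: vec_eq_iff axis_def)
  then have "0 < (\<Sum>i\<in>UNIV. subadd_transform A (axis i (x $ i)))"
    using subadd_transform_sum[OF A, of UNIV "\<lambda>i. axis i (x $ i)"] x(2)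
    by (metis finite_code less_le_trans)
  then obtain i where "0 < subadd_transform A (axis i (x $ i))"
    by (metis not_gr_zero sum.neutral)
  with x(1) show "\<exists>i. \<exists>t<\<infinity>. 0 < subadd_transform A (axis i t)"
    by (auto simp: finite_vecs_def)
next
  assume "\<exists>i. \<exists>t<\<infinity>. 0 < subadd_transform A (axis i t)"
  then obtain i t where "t < \<infinity>" "0 < subadd_transform A (axis i t)" by blast
  moreover from this have "axis i t \<in> finite_vecs"
    by (simp add: finite_vecs_def axis_def)
  ultimately show "\<exists>x\<in>finite_vecs. 0 < subadd_transform A x" by blast
qed

section \<open>The superadditive transformation\<close>

lemma superadd_transform_ge:
  fixes l :: nat
  assumes "1 \<le> l" "(\<Sum>j=1..l. y j) \<le> x"
  shows "(\<Sum>j=1..l. A (y j)) \<le> superadd_transform A x"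
  unfolding superadd_transform_def using assms by (intro Sup_upper) auto

lemma superadd_transform_leI:
  assumes "\<And>(l::nat) y. 1 \<le> l \<Longrightarrow> (\<Sum>j=1..l. y j) \<le> x \<Longrightarrow> (\<Sum>j=1..l. A (y j)) \<le> c"
  shows "superadd_transform A x \<le> c"
  unfolding superadd_transform_def using assms by (intro Sup_least) auto

lemma superadd_transform_ge_self: "A x \<le> superadd_transform A x"
  using superadd_transform_ge[of 1 "\<lambda>_. x" x A] by simp

lemma summand_le_sum_vec:
  fixes y :: "'b \<Rightarrow> ennreal ^ 'n"
  assumes "finite I" "i \<in> I"
  shows "y i \<le> (\<Sum>j\<in>I. y j)"
  using assms by (auto simp: less_eq_vec_def intro!: member_le_sum)

lemma aggregation_superadd_transform:
  assumes A: "aggregation_function A"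
  shows "aggregation_function (superadd_transform A)"
  unfolding aggregation_function_iff
proof (intro conjI allI impI)
  have "superadd_transform A 0 \<le> 0"
  proof (rule superadd_transform_leI)
    fix l :: nat and y :: "nat \<Rightarrow> ennreal ^ 'a"
    assume "(\<Sum>j=1..l. y j) \<le> 0"
    then have "A (y j) \<le> A 0" if "j \<in> {1..l}" for j
      using that summand_le_sum_vec[of "{1..l}" j y]
      by (intro aggregation_mono[OF A]) auto
    then show "(\<Sum>j=1..l. A (y j)) \<le> 0"
      by (simp add: aggregation_zero[OF A])
  qed
  then show "superadd_transform A 0 = 0" by simp
  fix x y :: "ennreal ^ 'a"
  assume "x \<le> y"
  then show "superadd_transform A x \<le> superadd_transform A y"
    by (intro superadd_transform_leI superadd_transform_ge) auto
qed

text \<open>Each member of a family with sum below \<open>x\<close> is itself below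
  \<open>x\<close>, hence finite, so only values on finite vectors enter.\<close>

lemma superadd_transform_cong:
  assumes eq: "\<And>x. x \<in> finite_vecs \<Longrightarrow> A x = B x" and x: "x \<in> finite_vecs"
  shows "superadd_transform A x = superadd_transform B x"
proof -
  have "(\<Sum>j=1..l. A (y j)) = (\<Sum>j=1..l. B (y j))" if "(\<Sum>j=1..l. y j) \<le> x" for l :: nat and y
    using that summand_le_sum_vec[of "{1..l}" _ y]
    by (intro sum.cong refl eq finite_vecs_downward[OF x]) (auto intro: order_trans)
  then show ?thesis
    by (intro antisym superadd_transform_leI) (metis superadd_transform_ge)+
qed

text \<open>Positivity at a finite vector passes from \<open>A\<close> up to its transform, which
  leaves finiteness as the only condition; it does not depend on the extension by
  \<open>superadd_transform_cong\<close>.\<close>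

lemma restrict_in_K_super_iff:
  assumes A: "A \<in> proper_aggregation"
  shows "restrict A finite_vecs \<in> K_super \<longleftrightarrow> (\<forall>x\<in>finite_vecs. superadd_transform A x < \<infinity>)"
proof
  assume "restrict A finite_vecs \<in> K_super"
  then obtain B where B: "restrict A finite_vecs = restrict B finite_vecs"
      "superadd_transform B \<in> proper_aggregation"
    by (auto simp: K_super_def)
  have "A x = B x" if "x \<in> finite_vecs" for x
    using B(1) that by (metis restrict_apply')
  then have "superadd_transform A x = superadd_transform B x" if "x \<in> finite_vecs" for x
    using that by (rule superadd_transform_cong)
  then show "\<forall>x\<in>finite_vecs. superadd_transform A x < \<infinity>"
    using B(2) by (auto simp: proper_aggregation_iff)
next
  assume "\<forall>x\<in>finite_vecs. superadd_transform A x < \<infinity>"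
  then have "superadd_transform A \<in> proper_aggregation"
    using A aggregation_superadd_transform[of A] less_le_trans[OF _ superadd_transform_ge_self]
    by (fastforce simp: proper_aggregation_iff)
  with A show "restrict A finite_vecs \<in> K_super" by (auto simp: K_super_def)
qed

section \<open>Comparison with the diagonal and conclusion\<close>

lemma proper_diagonal_function:
  assumes A: "A \<in> proper_aggregation"
  shows "unary (diagonal_function A) \<in> proper_aggregation"
proof -
  have agg: "aggregation_function A" and fin: "\<And>x. x \<in> finite_vecs \<Longrightarrow> A x < \<infinity>"
    using A by (auto simp: proper_aggregation_iff)
  obtain x where x: "x \<in> finite_vecs" "0 < A x"
    using A by (auto simp: proper_aggregation_iff)
  \<comment> \<open>The coordinate sum is finite and dominates every coordinate, so the diagonal
    point lies above \<open>x\<close>.\<close>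
  let ?s = "\<Sum>i\<in>UNIV. x $ i"
  have "x \<le> (\<chi> i. ?s)"
    by (auto simp: less_eq_vec_def intro!: member_le_sum)
  then have "0 < unary (diagonal_function A) (\<chi> _. ?s)"
    using aggregation_mono[OF agg] x(2)
    by (auto simp: unary_def diagonal_function_def intro: less_le_trans)
  moreover have "(\<chi> _. ?s) \<in> finite_vecs"
    using x(1) by (simp add: finite_vecs_def)
  moreover have "aggregation_function (unary (diagonal_function A))"
    using agg unfolding aggregation_function_iff unary_def diagonal_function_def
    by (auto simp: less_eq_vec_def zero_vec_def[symmetric])
  moreover have "unary (diagonal_function A) y < \<infinity>" if "y \<in> finite_vecs" for y
    unfolding unary_def diagonal_function_def
    using that by (intro fin) (simp add: finite_vecs_def)
  ultimately show ?thesis by (auto simp: proper_aggregation_iff)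
qed

text \<open>Scalars with sum at most t, placed on the diagonal, give vectors with sum at most (t,
  ..., t) and the same values.\<close>

lemma superadd_transform_diagonal_le:
  "superadd_transform (unary (diagonal_function A)) x \<le> superadd_transform A (\<chi> _. x $ 1)"
proof (rule superadd_transform_leI)
  fix l :: nat and y
  assume l: "1 \<le> l" and "(\<Sum>j=1..l. y j) \<le> x"
  then have "(\<Sum>j=1..l. \<chi> _. y j $ 1) \<le> ((\<chi> _. x $ 1) :: ennreal ^ 'a)"
    by (simp add: less_eq_vec_def)
  from superadd_transform_ge[OF l this]
  show "(\<Sum>j=1..l. unary (diagonal_function A) (y j)) \<le> superadd_transform A (\<chi> _. x $ 1)"
    by (simp add: unary_def diagonal_function_def)
qed

text \<open>Each \<open>y j\<close> is replaced by the larger diagonal vector of its coordinate sum.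
  Unlike the maximum, the coordinate sum is additive, so these scalars still add up to at most the
  coordinate sum of \<open>x\<close>.\<close>

lemma superadd_transform_le_diagonal:
  assumes A: "aggregation_function A"
  shows "superadd_transform A x
    \<le> superadd_transform (unary (diagonal_function A)) (\<chi> _. \<Sum>i\<in>UNIV. x $ i)"
proof (rule superadd_transform_leI)
  fix l :: nat and y
  assume l: "1 \<le> l" and y: "(\<Sum>j=1..l. y j) \<le> x"
  define s where "s j = (\<Sum>i\<in>UNIV. y j $ i)" for j
  have "(\<Sum>j=1..l. s j) = (\<Sum>i\<in>UNIV. (\<Sum>j=1..l. y j) $ i)"
    unfolding s_def by (subst sum.swap) simp
  also have "\<dots> \<le> (\<Sum>i\<in>UNIV. x $ i)"
    using y unfolding less_eq_vec_def by (intro sum_mono) auto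
  finally have le: "(\<Sum>j=1..l. \<chi> _. s j) \<le> ((\<chi> _. \<Sum>i\<in>UNIV. x $ i) :: ennreal ^ 1)"
    by (simp add: less_eq_vec_def)
  have "(\<Sum>j=1..l. A (y j)) \<le> (\<Sum>j=1..l. unary (diagonal_function A) (\<chi> _. s j))"
    unfolding unary_def diagonal_function_def s_def
    by (intro sum_mono aggregation_mono[OF A]) (auto simp: less_eq_vec_def intro!: member_le_sum)
  also have "\<dots> \<le> superadd_transform (unary (diagonal_function A)) (\<chi> _. \<Sum>i\<in>UNIV. x $ i)"
    by (rule superadd_transform_ge[OF l le])
  finally show "(\<Sum>j=1..l. A (y j))
    \<le> superadd_transform (unary (diagonal_function A)) (\<chi> _. \<Sum>i\<in>UNIV. x $ i)" .
qed

theorem theorem4: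
  fixes A :: "ennreal ^ 'n \<Rightarrow> ennreal"
  assumes "A \<in> proper_aggregation"
  shows "(restrict A finite_vecs \<in> K_super \<longleftrightarrow>
            restrict (unary (diagonal_function A)) finite_vecs \<in> K_super) \<and>
         (restrict A finite_vecs \<in> K_sub \<longleftrightarrow>
            (\<exists>i::'n. restrict (unary (axis_function A i)) finite_vecs \<in> K_sub))"
proof
  have agg: "aggregation_function A" and fin: "\<And>x. x \<in> finite_vecs \<Longrightarrow> A x < \<infinity>"
    using assms by (auto simp: proper_aggregation_iff)
  let ?D = "unary (diagonal_function A)"
  \<comment> \<open>Each transform is bounded by the other at a vector that is again finite: a
    diagonal point in one direction, the coordinate sum in the other.\<close>
  have "(\<forall>x\<in>finite_vecs. superadd_transform A x < \<infinity>) \<longleftrightarrow>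
      (\<forall>x\<in>finite_vecs. superadd_transform ?D x < \<infinity>)"
  proof (intro iffI ballI)
    fix x :: "ennreal ^ 1"
    assume "\<forall>x\<in>finite_vecs. superadd_transform A x < \<infinity>" "x \<in> finite_vecs"
    then show "superadd_transform ?D x < \<infinity>"
      by (intro le_less_trans[OF superadd_transform_diagonal_le]) (auto simp: finite_vecs_def)
  next
    fix x :: "ennreal ^ 'n"
    assume "\<forall>x\<in>finite_vecs. superadd_transform ?D x < \<infinity>" "x \<in> finite_vecs"
    then show "superadd_transform A x < \<infinity>"
      by (intro le_less_trans[OF superadd_transform_le_diagonal[OF agg]]) (auto simp: finite_vecs_def)
  qed
  then show "restrict A finite_vecs \<in> K_super \<longleftrightarrow> restrict ?D finite_vecs \<in> K_super"
    using restrict_in_K_super_iff[OF assms]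
      restrict_in_K_super_iff[OF proper_diagonal_function[OF assms]] by simp
  \<comment> \<open>Membership for one axis becomes positivity of the transform of \<open>A\<close>
    at a finite point of that axis, the form in which the axis criterion is stated.\<close>
  have "restrict (unary (axis_function A i)) finite_vecs \<in> K_sub \<longleftrightarrow>
      (\<exists>t<\<infinity>. 0 < subadd_transform A (axis i t))" for i
  proof -
    have "unary (axis_function A i) x < \<infinity>" if "x \<in> finite_vecs" for x
      unfolding unary_def axis_function_def
      using that by (intro fin) (simp add: finite_vecs_def axis_def)
    from restrict_in_K_sub_iff[OF aggregation_axis_function[OF agg] this]
    have "restrict (unary (axis_function A i)) finite_vecs \<in> K_sub \<longleftrightarrow>
      (\<exists>x\<in>finite_vecs. 0 < subadd_transform A (axis i ((x :: ennreal ^ 1) $ 1)))"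
      by (simp add: subadd_transform_axis[OF agg])
    also have "\<dots> \<longleftrightarrow> (\<exists>t<\<infinity>. 0 < subadd_transform A (axis i t))"
    proof
      assume "\<exists>t<\<infinity>. 0 < subadd_transform A (axis i t)"
      then obtain t where "t < \<infinity>" "0 < subadd_transform A (axis i t)" by blast
      then show "\<exists>x\<in>finite_vecs. 0 < subadd_transform A (axis i ((x :: ennreal ^ 1) $ 1))"
        by (intro bexI[of _ "\<chi> _. t"]) (auto simp: finite_vecs_def)
    qed (auto simp: finite_vecs_def)
    finally show ?thesis .
  qed
  then show "restrict A finite_vecs \<in> K_sub \<longleftrightarrow>
      (\<exists>i. restrict (unary (axis_function A i)) finite_vecs \<in> K_sub)"
    using restrict_in_K_sub_iff[OF agg fin] subadd_transform_pos_iff_axis[OF agg] by simp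
qed

end
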